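(* Let $m,n$ be positive integers and let $A,B,C\in \mathbb{M}_m(\mathbb{M}_n)$ be positive semidefinite. (1) For every subgroup $G$ of $S_m$ and every irreducible character $\chi$ of $G$, \[ (\mathrm{d}_{\chi}^G)_1(A+B+C)+(\mathrm{d}_{\chi}^G)_1 A+(\mathrm{d}_{\chi}^G)_1 B+(\mathrm{d}_{\chi}^G)_1 C \;\ge\; (\mathrm{d}_{\chi}^G)_1(A+B)+(\mathrm{d}_{\chi}^G)_1(A+C)+(\mathrm{d}_{\chi}^G)_1(B+C). \] (2) For every subgroup $G$ of $S_n$ and every irreducible character $\chi$ of $G$, \[ (\mathrm{d}_{\chi}^G)_2(A+B+C)+(\mathrm{d}_{\chi}^G)_2 A+(\mathrm{d}_{\chi}^G)_2 B+(\mathrm{d}_{\chi}^G)_2 C \;\ge\; (\mathrm{d}_{\chi}^G)_2(A+B)+(\mathrm{d}_{\chi}^G)_2(A+C)+(\mathrm{d}_{\chi}^G)_2(B+C). \]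
   Context: $\mathbb{M}_k$ is the space of $k\times k$ complex matrices, and $\mathbb{M}_m(\mathbb{M}_n)$ is the set of $m\times m$ block matrices $A=[A_{ij}]_{i,j=1}^m$ with blocks $A_{ij}\in\mathbb{M}_n$ (positive semidefiniteness refers to $A$ viewed as an $mn\times mn$ complex Hermitian matrix). For Hermitian matrices $X,Y$ of the same size, $X\ge Y$ means that $X-Y$ is positive semidefinite. Generalized matrix function: if $G$ is a subgroup of the symmetric group $S_k$ and $\chi$ is an irreducible (complex) character of $G$, then for $X=(x_{ij})\in\mathbb{M}_k$, \[\mathrm{d}_{\chi}^G(X)=\sum_{\sigma\in G}\chi(\sigma)\prod_{i=1}^k x_{i\sigma(i)}.\] Partial generalized matrix functions: let $A=[A_{ij}]_{i,j=1}^m\in\mathbb{M}_m(\mathbb{M}_n)$ with $A_{ij}=[a_{rs}^{ij}]_{r,s=1}^n$. For $G\le S_n$, \[(\mathrm{d}_{\chi}^G)_2A=[\mathrm{d}_{\chi}^G(A_{ij})]_{i,j=1}^m\in\mathbb{M}_m.\] For $G\le S_m$, put $B_{rs}=[a_{rs}^{ij}]_{i,j=1}^m\in\mathbb{M}_m$ for $1\le r,s\le n$, and \[(\mathrm{d}_{\chi}^G)_1A=[\mathrm{d}_{\chi}^G(B_{rs})]_{r,s=1}^n\in\mathbb{M}_n.\] *)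

theory Defs
  imports
    "HOL-Algebra.Sym_Groups"
    "Jordan_Normal_Form.Schur_Decomposition"
    "Jordan_Normal_Form.VS_Connect"
begin

definition hermitian_mat :: "nat \<Rightarrow> complex mat \<Rightarrow> bool" where
  "hermitian_mat k A \<longleftrightarrow> A \<in> carrier_mat k k \<and> mat_adjoint A = A"

(* "0 \<le> z" for complex z means that z is real and nonnegative. *)
definition positive_semidefinite :: "nat \<Rightarrow> complex mat \<Rightarrow> bool" where
  "positive_semidefinite k A \<longleftrightarrow>
     hermitian_mat k A \<and> (\<forall>v \<in> carrier_vec k. 0 \<le> (A *\<^sub>v v) \<bullet>c v)"

(* X \<ge> Y; the order relates Hermitian matrices only, so it includes that both sides are Hermitian. *)
definition loewner_ge :: "nat \<Rightarrow> complex mat \<Rightarrow> complex mat \<Rightarrow> bool" where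
  "loewner_ge k X Y \<longleftrightarrow>
     hermitian_mat k X \<and> hermitian_mat k Y \<and> positive_semidefinite k (X - Y)"

(* The group of units of the ring of d x d matrices is GL_d. *)
definition representation ::
  "('g, 'b) monoid_scheme \<Rightarrow> nat \<Rightarrow> ('g \<Rightarrow> complex mat) \<Rightarrow> bool" where
  "representation H d \<rho> \<longleftrightarrow> \<rho> \<in> hom H (units_of (ring_mat TYPE(complex) d ()))"

definition irreducible_representation ::
  "('g, 'b) monoid_scheme \<Rightarrow> nat \<Rightarrow> ('g \<Rightarrow> complex mat) \<Rightarrow> bool" where
  "irreducible_representation H d \<rho> \<longleftrightarrow>
     representation H d \<rho> \<and> d > 0 \<and>
     (\<forall>W. VectorSpace.subspace class_ring W (module_vec TYPE(complex) d) \<and>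
          (\<forall>g \<in> carrier H. \<forall>w \<in> W. \<rho> g *\<^sub>v w \<in> W)
        \<longrightarrow> W = {0\<^sub>v d} \<or> W = carrier_vec d)"

(* The values of \<chi> outside the carrier of H are unconstrained and never used. *)
definition irreducible_character ::
  "('g, 'b) monoid_scheme \<Rightarrow> ('g \<Rightarrow> complex) \<Rightarrow> bool" where
  "irreducible_character H \<chi> \<longleftrightarrow>
     (\<exists>d \<rho>. irreducible_representation H d \<rho> \<and>
        (\<forall>g \<in> carrier H. \<chi> g = (\<Sum>i<d. \<rho> g $$ (i, i))))"

(* Permutations in sym_group k act on {1..k}, whereas matrix indices start at 0:
   the entry x_{ij} is X $$ (i - 1, j - 1). *)
definition gen_mat_fun ::
  "(nat \<Rightarrow> nat) set \<Rightarrow> ((nat \<Rightarrow> nat) \<Rightarrow> complex) \<Rightarrow> nat \<Rightarrow> complex mat \<Rightarrow> complex" where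
  "gen_mat_fun G \<chi> k X = (\<Sum>\<sigma>\<in>G. \<chi> \<sigma> * (\<Prod>i = 1..k. X $$ (i - 1, \<sigma> i - 1)))"

(* An m x m block matrix with n x n blocks is an (m * n) x (m * n) matrix whose (i, j) block
   has (r, s) entry A $$ (i * n + r, j * n + s), for 0-based i, j < m and r, s < n. *)
definition block :: "nat \<Rightarrow> complex mat \<Rightarrow> nat \<Rightarrow> nat \<Rightarrow> complex mat" where
  "block n A i j = mat n n (\<lambda>(r, s). A $$ (i * n + r, j * n + s))"

(* The matrix B_{rs} collecting the (r, s) entries of all blocks. *)
definition cross_block :: "nat \<Rightarrow> nat \<Rightarrow> complex mat \<Rightarrow> nat \<Rightarrow> nat \<Rightarrow> complex mat" where
  "cross_block m n A r s = mat m m (\<lambda>(i, j). block n A i j $$ (r, s))"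

definition partial_gmf1 ::
  "(nat \<Rightarrow> nat) set \<Rightarrow> ((nat \<Rightarrow> nat) \<Rightarrow> complex) \<Rightarrow> nat \<Rightarrow> nat \<Rightarrow> complex mat \<Rightarrow> complex mat" where
  "partial_gmf1 G \<chi> m n A = mat n n (\<lambda>(r, s). gen_mat_fun G \<chi> m (cross_block m n A r s))"

definition partial_gmf2 ::
  "(nat \<Rightarrow> nat) set \<Rightarrow> ((nat \<Rightarrow> nat) \<Rightarrow> complex) \<Rightarrow> nat \<Rightarrow> nat \<Rightarrow> complex mat \<Rightarrow> complex mat" where
  "partial_gmf2 G \<chi> m n A = mat m m (\<lambda>(i, j). gen_mat_fun G \<chi> n (block n A i j))"

end

theory Submission
  imports Defs
begin

text \<open>
  Call a kernel a Gram kernel if it is a finite sum of rank-one kernels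
  \<open>f x * cnj (f y)\<close>. Gram kernels are closed under sums, pointwise products and
  marginals, and on a finite set they are exactly the positive semidefinite kernels.
  A character is positive definite: with \<open>P = (\<Sum>g. \<rho>(g)* \<rho>(g))\<close> one has
  \<open>\<rho>(\<tau>\<inverse>) = P\<inverse> \<rho>(\<tau>)* P\<close>, so \<open>\<chi>(\<sigma> \<tau>\<inverse>)\<close> is a Gram kernel in \<open>(\<tau>, \<sigma>)\<close>.
  Averaging the generalized matrix function over \<open>\<tau> \<in> G\<close> gives, in block position \<open>(p, q)\<close>,
  \<open>(1/|G|) (\<Sum>\<tau> \<sigma>. \<chi>(\<sigma> \<tau>\<inverse>) (\<Prod>i. A (p, \<tau> i) (q, \<sigma> i)))\<close>, a marginal of a product of Gram
  kernels. For the combination of \<open>A\<close>, \<open>B\<close>, \<open>C\<close> in the theorem, the products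
  combine by inclusion-exclusion to the sum of all mixed products that use each of \<open>A\<close>, \<open>B\<close>
  and \<open>C\<close>, which is again a Gram kernel.
\<close>

section \<open>Gram kernels and their closure properties\<close>

text \<open>The list is an explicit factorisation with one feature function per rank-one term, so
  that closure properties become operations on lists. Only the values of \<open>K\<close> on
  \<open>S\<close> are constrained.\<close>

definition gram_on :: "'a set \<Rightarrow> ('a \<Rightarrow> 'a \<Rightarrow> complex) \<Rightarrow> bool" where
  "gram_on S K \<longleftrightarrow> (\<exists>fs. \<forall>x\<in>S. \<forall>y\<in>S. K x y = (\<Sum>f\<leftarrow>fs. f x * cnj (f y)))"

lemma gram_onI:
  assumes "\<And>x y. x \<in> S \<Longrightarrow> y \<in> S \<Longrightarrow> K x y = (\<Sum>f\<leftarrow>fs. f x * cnj (f y))"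
  shows "gram_on S K"
  using assms unfolding gram_on_def by blast

lemma gram_on_cong:
  assumes "gram_on S K" and "\<And>x y. x \<in> S \<Longrightarrow> y \<in> S \<Longrightarrow> K x y = L x y"
  shows "gram_on S L"
  using assms unfolding gram_on_def by metis

lemma gram_on_rank_one: "gram_on S (\<lambda>x y. f x * cnj (f y))"
  by (rule gram_onI[where fs = "[f]"]) simp

lemma gram_on_zero: "gram_on S (\<lambda>x y. 0)"
  by (rule gram_onI[where fs = "[]"]) simp

lemma gram_on_one: "gram_on S (\<lambda>x y. 1)"
  using gram_on_rank_one[of S "\<lambda>_. 1"] by simp

lemma gram_on_add:
  assumes "gram_on S K" and "gram_on S L"
  shows "gram_on S (\<lambda>x y. K x y + L x y)"
proof -
  obtain fs where fs: "\<And>x y. x \<in> S \<Longrightarrow> y \<in> S \<Longrightarrow> K x y = (\<Sum>f\<leftarrow>fs. f x * cnj (f y))"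
    using assms(1) unfolding gram_on_def by blast
  obtain gs where gs: "\<And>x y. x \<in> S \<Longrightarrow> y \<in> S \<Longrightarrow> L x y = (\<Sum>g\<leftarrow>gs. g x * cnj (g y))"
    using assms(2) unfolding gram_on_def by blast
  show ?thesis by (rule gram_onI[where fs = "fs @ gs"]) (simp add: fs gs)
qed

lemma gram_on_sum_list:
  assumes "\<And>f. f \<in> set fs \<Longrightarrow> gram_on S (K f)"
  shows "gram_on S (\<lambda>x y. \<Sum>f\<leftarrow>fs. K f x y)"
  using assms by (induction fs) (auto intro: gram_on_zero gram_on_add)

lemma gram_on_sum:
  assumes "\<And>j. j \<in> J \<Longrightarrow> gram_on S (K j)"
  shows "gram_on S (\<lambda>x y. \<Sum>j\<in>J. K j x y)"
  using assms
  by (induction J rule: infinite_finite_induct) (auto intro: gram_on_zero gram_on_add)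

lemma sum_list_product:
  fixes F :: "'a \<Rightarrow> 'c :: semiring_0"
  shows "(\<Sum>f\<leftarrow>fs. F f) * (\<Sum>g\<leftarrow>gs. G g) = (\<Sum>f\<leftarrow>fs. \<Sum>g\<leftarrow>gs. F f * G g)"
  by (induction fs) (simp_all add: distrib_right sum_list_const_mult)

text \<open>This is the Schur product theorem: rank-one kernels with features \<open>f\<close> and
  \<open>g\<close> multiply to a rank-one kernel with feature \<open>f x * g x\<close>, and the
  product of two sums expands into such terms.\<close>

lemma gram_on_mult:
  assumes "gram_on S K" and "gram_on S L"
  shows "gram_on S (\<lambda>x y. K x y * L x y)"
proof -
  obtain fs where fs: "\<And>x y. x \<in> S \<Longrightarrow> y \<in> S \<Longrightarrow> K x y = (\<Sum>f\<leftarrow>fs. f x * cnj (f y))"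
    using assms(1) unfolding gram_on_def by blast
  obtain gs where gs: "\<And>x y. x \<in> S \<Longrightarrow> y \<in> S \<Longrightarrow> L x y = (\<Sum>g\<leftarrow>gs. g x * cnj (g y))"
    using assms(2) unfolding gram_on_def by blast
  have "gram_on S (\<lambda>x y. \<Sum>f\<leftarrow>fs. \<Sum>g\<leftarrow>gs. (f x * g x) * cnj (f y * g y))"
    by (intro gram_on_sum_list gram_on_rank_one)
  then show ?thesis
    by (rule gram_on_cong)
       (simp add: fs gs sum_list_product mult_ac)
qed

lemma gram_on_prod:
  assumes "\<And>j. j \<in> J \<Longrightarrow> gram_on S (K j)"
  shows "gram_on S (\<lambda>x y. \<Prod>j\<in>J. K j x y)"
  using assms
  by (induction J rule: infinite_finite_induct) (auto intro: gram_on_one gram_on_mult)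

lemma gram_on_scale:
  assumes "gram_on S K" and "r \<ge> 0"
  shows "gram_on S (\<lambda>x y. complex_of_real r * K x y)"
proof -
  have "gram_on S (\<lambda>x y. complex_of_real (sqrt r) * cnj (complex_of_real (sqrt r)))"
    by (rule gram_on_rank_one)
  then have "gram_on S (\<lambda>x y. complex_of_real r)"
    by (rule gram_on_cong) (use assms(2) in \<open>simp flip: of_real_mult\<close>)
  then show ?thesis by (rule gram_on_mult) (rule assms(1))
qed

lemma gram_on_transpose:
  assumes "gram_on S K"
  shows "gram_on S (\<lambda>x y. K y x)"
proof -
  obtain fs where fs: "\<And>x y. x \<in> S \<Longrightarrow> y \<in> S \<Longrightarrow> K x y = (\<Sum>f\<leftarrow>fs. f x * cnj (f y))"
    using assms unfolding gram_on_def by blast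
  show ?thesis
    by (rule gram_onI[where fs = "map (\<lambda>f x. cnj (f x)) fs"]) (simp add: fs o_def mult_ac)
qed

lemma gram_on_pullback:
  assumes "gram_on S K" and "\<And>x. x \<in> T \<Longrightarrow> \<phi> x \<in> S"
  shows "gram_on T (\<lambda>x y. K (\<phi> x) (\<phi> y))"
proof -
  obtain fs where fs: "\<And>x y. x \<in> S \<Longrightarrow> y \<in> S \<Longrightarrow> K x y = (\<Sum>f\<leftarrow>fs. f x * cnj (f y))"
    using assms(1) unfolding gram_on_def by blast
  show ?thesis
    by (rule gram_onI[where fs = "map (\<lambda>f x. f (\<phi> x)) fs"]) (simp add: fs assms(2) o_def)
qed

lemma sum_sum_list_swap:
  "(\<Sum>x\<in>X. \<Sum>f\<leftarrow>fs. F x f) = (\<Sum>f\<leftarrow>fs. \<Sum>x\<in>X. F x f :: 'c :: comm_monoid_add)"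
  by (induction fs) (simp_all add: sum.distrib)

text \<open>The double sum of a rank-one term factors, so the features of the marginal are the sums
  of \<open>f (x, u)\<close> over \<open>u\<close>.\<close>

lemma gram_on_marginal:
  assumes "gram_on (S \<times> T) K"
  shows "gram_on S (\<lambda>x y. \<Sum>u\<in>T. \<Sum>v\<in>T. K (x, u) (y, v))"
proof -
  obtain fs where fs:
    "\<And>x y. x \<in> S \<times> T \<Longrightarrow> y \<in> S \<times> T \<Longrightarrow> K x y = (\<Sum>f\<leftarrow>fs. f x * cnj (f y))"
    using assms unfolding gram_on_def by blast
  show ?thesis
    by (rule gram_onI[where fs = "map (\<lambda>f x. \<Sum>u\<in>T. f (x, u)) fs"])
       (simp add: fs o_def sum_sum_list_swap sum_product)
qed

lemma gram_on_hermitian: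
  assumes "gram_on S K" and "x \<in> S" and "y \<in> S"
  shows "K y x = cnj (K x y)"
proof -
  obtain fs where fs: "\<And>x y. x \<in> S \<Longrightarrow> y \<in> S \<Longrightarrow> K x y = (\<Sum>f\<leftarrow>fs. f x * cnj (f y))"
    using assms(1) unfolding gram_on_def by blast
  have "cnj (\<Sum>f\<leftarrow>fs. f x * cnj (f y)) = (\<Sum>f\<leftarrow>fs. f y * cnj (f x))"
    by (induction fs) (simp_all add: mult_ac)
  then show ?thesis by (simp add: fs assms)
qed

lemma gram_on_nonneg:
  assumes "gram_on S K"
  shows "0 \<le> (\<Sum>x\<in>S. \<Sum>y\<in>S. cnj (c x) * K x y * c y)"
proof -
  have "gram_on S (\<lambda>x y. cnj (c x) * cnj (cnj (c y)) * K x y)"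
    by (intro gram_on_mult gram_on_rank_one assms)
  \<comment> \<open>A one-point first component turns the whole quadratic form into a marginal. A
    Gram kernel on a single point is a sum of squared moduli.\<close>
  then have "gram_on (UNIV \<times> S) (\<lambda>p q. cnj (c (snd p)) * cnj (cnj (c (snd q))) * K (snd p) (snd q))"
    by (rule gram_on_pullback) auto
  from gram_on_marginal[OF this]
  have "gram_on (UNIV :: unit set) (\<lambda>_ _. \<Sum>x\<in>S. \<Sum>y\<in>S. cnj (c x) * K x y * c y)"
    by (simp add: mult_ac)
  then obtain fs :: "(unit \<Rightarrow> complex) list" where
    "(\<Sum>x\<in>S. \<Sum>y\<in>S. cnj (c x) * K x y * c y) = (\<Sum>f\<leftarrow>fs. f () * cnj (f ()))"
    unfolding gram_on_def by blast
  moreover have "0 \<le> (\<Sum>f\<leftarrow>fs. f () * cnj (f ()))"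
    by (induction fs) (auto simp: complex_mult_cnj less_eq_complex_def)
  ultimately show ?thesis by simp
qed

section \<open>Positive semidefinite kernels are Gram kernels\<close>

definition psd_on :: "'a set \<Rightarrow> ('a \<Rightarrow> 'a \<Rightarrow> complex) \<Rightarrow> bool" where
  "psd_on S K \<longleftrightarrow> (\<forall>x\<in>S. \<forall>y\<in>S. K y x = cnj (K x y)) \<and>
     (\<forall>c. 0 \<le> (\<Sum>x\<in>S. \<Sum>y\<in>S. cnj (c x) * K x y * c y))"

text \<open>Coefficients on \<open>T\<close> extend by zero to \<open>S\<close> without changing the
  quadratic form.\<close>

lemma psd_on_subset:
  assumes psd: "psd_on S K" and "finite S" and "T \<subseteq> S"
  shows "psd_on T K"
  unfolding psd_on_def
proof (intro conjI allI)
  show "\<forall>x\<in>T. \<forall>y\<in>T. K y x = cnj (K x y)"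
    using psd \<open>T \<subseteq> S\<close> unfolding psd_on_def by blast
next
  fix c :: "'a \<Rightarrow> complex"
  define c' where "c' = (\<lambda>x. if x \<in> T then c x else 0)"
  have "(\<Sum>x\<in>T. \<Sum>y\<in>T. cnj (c x) * K x y * c y) = (\<Sum>x\<in>T. \<Sum>y\<in>S. cnj (c' x) * K x y * c' y)"
    by (intro sum.cong sum.mono_neutral_cong_left refl) (use assms in \<open>auto simp: c'_def\<close>)
  also have "\<dots> = (\<Sum>x\<in>S. \<Sum>y\<in>S. cnj (c' x) * K x y * c' y)"
    by (intro sum.mono_neutral_left) (use assms in \<open>auto simp: c'_def\<close>)
  also have "0 \<le> \<dots>"
    using psd unfolding psd_on_def by blast
  finally show "0 \<le> (\<Sum>x\<in>T. \<Sum>y\<in>T. cnj (c x) * K x y * c y)" .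
qed

lemma psd_on_diagonal:
  assumes "psd_on S K" and "finite S" and "a \<in> S"
  shows "0 \<le> K a a"
proof -
  have "psd_on {a} K" using assms by (intro psd_on_subset[OF assms(1)]) auto
  then have "0 \<le> (\<Sum>x\<in>{a}. \<Sum>y\<in>{a}. cnj (c x) * K x y * c y)" for c
    unfolding psd_on_def by blast
  from this[of "\<lambda>_. 1"] show ?thesis by simp
qed

text \<open>If \<open>K a a = 0\<close>, the form on \<open>{x, a}\<close> with coefficient 1 at
  \<open>x\<close> has no quadratic term in the coefficient at \<open>a\<close>. A nonzero
  \<open>K x a\<close> would then make it unbounded below.\<close>

lemma psd_on_zero_diagonal:
  assumes "psd_on S K" and "finite S" and "a \<in> S" and "x \<in> S" and "K a a = 0"
  shows "K x a = 0"
proof (cases "x = a")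
  case False
  have psd: "psd_on {x, a} K" using assms by (intro psd_on_subset[OF assms(1)]) auto
  define z where "z = K x a"
  have herm: "K a x = cnj z" using psd unfolding psd_on_def z_def by blast
  have xx: "0 \<le> K x x" by (rule psd_on_diagonal[OF assms(1,2,4)])
  have bound: "0 \<le> Re (K x x) - 2 * s * (cmod z)\<^sup>2" for s
  proof -
    \<comment> \<open>The phase \<open>cnj z\<close> makes both cross terms equal to
      \<open>- s * (z * cnj z)\<close>, so the form decreases linearly in \<open>s\<close>.\<close>
    define c where "c = (\<lambda>y. if y = x then 1 else - (complex_of_real s * cnj z))"
    have "0 \<le> (\<Sum>u\<in>{x, a}. \<Sum>v\<in>{x, a}. cnj (c u) * K u v * c v)"
      using psd unfolding psd_on_def by blast
    also have "\<dots> = K x x - 2 * complex_of_real s * (z * cnj z)"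
      using False \<open>K a a = 0\<close> herm by (simp add: c_def z_def[symmetric] algebra_simps)
    finally show ?thesis
      by (simp add: less_eq_complex_def complex_mult_cnj cmod_power2)
  qed
  show ?thesis
  proof (rule ccontr)
    assume "K x a \<noteq> 0"
    then have "(cmod z)\<^sup>2 > 0" by (simp add: z_def)
    \<comment> \<open>This \<open>s\<close> makes the lower-bounded expression equal to -1.\<close>
    then show False
      using bound[of "(Re (K x x) + 1) / (2 * (cmod z)\<^sup>2)"] by (simp add: z_def)
  qed
qed (use assms in simp)

text \<open>With \<open>x / 0 = 0\<close>, the Schur complement of a zero pivot is the kernel itself.\<close>

lemma psd_on_schur_complement:
  assumes psd: "psd_on (insert a S) K" and fin: "finite S" and "a \<notin> S"
  shows "psd_on S (\<lambda>x y. K x y - K x a * K a y / K a a)"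
  unfolding psd_on_def
proof (intro conjI allI)
  have herm: "K y x = cnj (K x y)" if "x \<in> insert a S" "y \<in> insert a S" for x y
    using psd that unfolding psd_on_def by blast
  have kaa: "cnj (K a a) = K a a" using herm[of a a] by simp
  then show "\<forall>x\<in>S. \<forall>y\<in>S. K y x - K y a * K a x / K a a
     = cnj (K x y - K x a * K a y / K a a)"
    by (auto simp: herm[symmetric])
  fix c
  define u where "u = (\<Sum>y\<in>S. K a y * c y)"
  \<comment> \<open>This coefficient at \<open>a\<close> completes the square. For a zero pivot it
    is 0, and the form reduces to \<open>?Q\<close>.\<close>
  define b where "b = - u / K a a"
  have u': "cnj u = (\<Sum>x\<in>S. cnj (c x) * K x a)"
    by (simp add: u_def herm[symmetric] mult_ac)
  let ?Q = "\<Sum>x\<in>S. \<Sum>y\<in>S. cnj (c x) * K x y * c y"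
  have "0 \<le> (\<Sum>x\<in>insert a S. \<Sum>y\<in>insert a S. cnj ((c(a := b)) x) * K x y * (c(a := b)) y)"
    using psd unfolding psd_on_def by blast
  also have "\<dots> = cnj b * K a a * b + (\<Sum>y\<in>S. cnj b * K a y * c y)
      + (\<Sum>x\<in>S. cnj (c x) * K x a * b + (\<Sum>y\<in>S. cnj (c x) * K x y * c y))"
  proof -
    have "(c(a := b)) y = c y" if "y \<in> S" for y using that \<open>a \<notin> S\<close> by auto
    then show ?thesis using fin \<open>a \<notin> S\<close> by simp
  qed
  also have "\<dots> = cnj b * K a a * b + cnj b * u + cnj u * b + ?Q"
    unfolding u' unfolding u_def
    by (simp add: sum.distrib sum_distrib_left sum_distrib_right mult_ac)
  also have "\<dots> = ?Q - cnj u * u / K a a"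
    by (cases "K a a = 0") (simp_all add: b_def kaa field_simps)
  also have "cnj u * u / K a a = (\<Sum>x\<in>S. \<Sum>y\<in>S. cnj (c x) * (K x a * K a y / K a a) * c y)"
    unfolding u' unfolding u_def sum_product sum_divide_distrib by (simp add: mult_ac)
  finally show "0 \<le> (\<Sum>x\<in>S. \<Sum>y\<in>S. cnj (c x) * (K x y - K x a * K a y / K a a) * c y)"
    by (simp add: sum_subtractf algebra_simps)
qed

text \<open>Cholesky factorisation by induction: \<open>K\<close> is its Schur complement at the
  pivot \<open>a\<close>, which is Gram on \<open>S\<close> by induction, plus one rank-one kernel
  built from column \<open>a\<close>.\<close>

lemma psd_on_imp_gram_on:
  assumes "finite S" and "psd_on S K"
  shows "gram_on S K"
  using assms
proof (induction S arbitrary: K rule: finite_induct)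
  case empty
  show ?case by (simp add: gram_on_def)
next
  case (insert a S)
  let ?L = "\<lambda>x y. K x y - K x a * K a y / K a a"
  let ?S = "insert a S"
  have herm: "K y x = cnj (K x y)" if "x \<in> ?S" "y \<in> ?S" for x y
    using insert.prems that unfolding psd_on_def by blast
  have pos: "0 \<le> K a a"
    using psd_on_diagonal[OF insert.prems, of a] insert.hyps by simp
  have zero: "K x a = 0" if "K a a = 0" "x \<in> ?S" for x
    using psd_on_zero_diagonal[OF insert.prems, of a x] insert.hyps that by simp
  have "gram_on S ?L"
    by (rule insert.IH[OF psd_on_schur_complement[OF insert.prems insert.hyps]])
  then obtain fs where fs: "\<And>x y. x \<in> S \<Longrightarrow> y \<in> S \<Longrightarrow> ?L x y = (\<Sum>f\<leftarrow>fs. f x * cnj (f y))"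
    unfolding gram_on_def by blast
  have col: "?L x a = 0" if "x \<in> ?S" for x
    using zero[OF _ that] by (cases "K a a = 0") auto
  have row: "?L a y = 0" if "y \<in> ?S" for y
  proof (cases "K a a = 0")
    case True
    then have "K a y = 0" using zero[OF True that] by (subst herm[OF that]) auto
    with True show ?thesis by simp
  qed simp
  \<comment> \<open>Row and column \<open>a\<close> of \<open>?L\<close> vanish, so the features
    found on \<open>S\<close> are extended by 0 at \<open>a\<close>.\<close>
  have "gram_on ?S ?L"
  proof (rule gram_onI[where fs = "map (\<lambda>f x. if x = a then 0 else f x) fs"])
    fix x y assume "x \<in> ?S" "y \<in> ?S"
    then show "?L x y = (\<Sum>f\<leftarrow>map (\<lambda>f x. if x = a then 0 else f x) fs. f x * cnj (f y))"
      using col row fs by (cases "x = a"; cases "y = a") (simp_all add: o_def)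
  qed
  \<comment> \<open>Column \<open>a\<close> scaled by the root of the pivot restores what
    \<open>?L\<close> subtracts; for a zero pivot both terms are 0.\<close>
  moreover have "gram_on ?S (\<lambda>x y. K x a / csqrt (K a a) * cnj (K y a / csqrt (K a a)))"
    by (rule gram_on_rank_one)
  ultimately have "gram_on ?S (\<lambda>x y. ?L x y + K x a / csqrt (K a a) * cnj (K y a / csqrt (K a a)))"
    by (rule gram_on_add)
  then show ?case
  proof (rule gram_on_cong)
    fix x y assume "x \<in> ?S" "y \<in> ?S"
    have "csqrt (K a a) * cnj (csqrt (K a a)) = K a a"
      using pos by (simp add: complex_eq_iff less_eq_complex_def)
    then show "?L x y + K x a / csqrt (K a a) * cnj (K y a / csqrt (K a a)) = K x y"
      using herm[of y a] \<open>y \<in> ?S\<close> by simp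
  qed
qed

section \<open>Inclusion-exclusion for products of Gram kernels\<close>

text \<open>Expanded, the difference is the sum of the mixed products with at least one factor
  \<open>b\<close>. If factor \<open>i\<close> is \<open>a i\<close>, the others must supply a
  \<open>b\<close>; if it is \<open>b i\<close>, they are free.\<close>

lemma gram_on_prod_diff:
  assumes "\<And>j. j \<in> J \<Longrightarrow> gram_on S (a j)" and "\<And>j. j \<in> J \<Longrightarrow> gram_on S (b j)"
  shows "gram_on S (\<lambda>x y. (\<Prod>j\<in>J. a j x y + b j x y) - (\<Prod>j\<in>J. a j x y))"
  using assms
proof (induction J rule: infinite_finite_induct)
  case (insert i J)
  have "gram_on S (\<lambda>x y. a i x y * ((\<Prod>j\<in>J. a j x y + b j x y) - (\<Prod>j\<in>J. a j x y))
      + b i x y * (\<Prod>j\<in>J. a j x y + b j x y))"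
    using insert by (intro gram_on_add gram_on_mult gram_on_prod) auto
  then show ?case by (rule gram_on_cong) (simp add: insert.hyps algebra_simps)
qed (simp_all add: gram_on_zero)

text \<open>For finite \<open>J\<close> these are the mixed products using both \<open>b\<close> and
  \<open>c\<close>. Taking \<open>b i\<close> leaves products with at least one \<open>c\<close>,
  taking \<open>c i\<close> leaves products with at least one \<open>b\<close>; both are covered by
  \<open>gram_on_prod_diff\<close>.\<close>

lemma gram_on_prod_superadditive:
  assumes "\<And>j. j \<in> J \<Longrightarrow> gram_on S (a j)" and "\<And>j. j \<in> J \<Longrightarrow> gram_on S (b j)"
    and "\<And>j. j \<in> J \<Longrightarrow> gram_on S (c j)"
  shows "gram_on S (\<lambda>x y. (\<Prod>j\<in>J. a j x y + b j x y + c j x y) + (\<Prod>j\<in>J. a j x y)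
    - (\<Prod>j\<in>J. a j x y + b j x y) - (\<Prod>j\<in>J. a j x y + c j x y))"
  using assms
proof (induction J rule: infinite_finite_induct)
  case (insert i J)
  have "gram_on S (\<lambda>x y. (\<Prod>j\<in>J. (a j x y + b j x y) + c j x y) - (\<Prod>j\<in>J. a j x y + b j x y))"
    using insert by (intro gram_on_prod_diff gram_on_add) auto
  moreover have "gram_on S (\<lambda>x y. (\<Prod>j\<in>J. (a j x y + c j x y) + b j x y) - (\<Prod>j\<in>J. a j x y + c j x y))"
    using insert by (intro gram_on_prod_diff gram_on_add) auto
  ultimately have "gram_on S (\<lambda>x y. a i x y * ((\<Prod>j\<in>J. a j x y + b j x y + c j x y)
      + (\<Prod>j\<in>J. a j x y) - (\<Prod>j\<in>J. a j x y + b j x y) - (\<Prod>j\<in>J. a j x y + c j x y))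
    + b i x y * ((\<Prod>j\<in>J. (a j x y + b j x y) + c j x y) - (\<Prod>j\<in>J. a j x y + b j x y))
    + c i x y * ((\<Prod>j\<in>J. (a j x y + c j x y) + b j x y) - (\<Prod>j\<in>J. a j x y + c j x y)))"
    using insert by (intro gram_on_add gram_on_mult) auto
  then show ?case by (rule gram_on_cong) (simp add: insert.hyps algebra_simps)
qed (simp_all add: gram_on_zero)

text \<open>For finite nonempty \<open>J\<close> these are the mixed products using each of
  \<open>a\<close>, \<open>b\<close> and \<open>c\<close>. Once factor \<open>i\<close> is chosen,
  the remaining ones must use the other two kernels, which is
  \<open>gram_on_prod_superadditive\<close>.\<close>

lemma gram_on_prod_hlawka:
  assumes a: "\<And>j. j \<in> J \<Longrightarrow> gram_on S (a j)" and b: "\<And>j. j \<in> J \<Longrightarrow> gram_on S (b j)"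
    and c: "\<And>j. j \<in> J \<Longrightarrow> gram_on S (c j)"
  shows "gram_on S (\<lambda>x y. (\<Prod>j\<in>J. a j x y + b j x y + c j x y)
    + (\<Prod>j\<in>J. a j x y) + (\<Prod>j\<in>J. b j x y) + (\<Prod>j\<in>J. c j x y)
    - ((\<Prod>j\<in>J. a j x y + b j x y) + (\<Prod>j\<in>J. a j x y + c j x y) + (\<Prod>j\<in>J. b j x y + c j x y)))"
  using assms
proof (induction J rule: infinite_finite_induct)
  case (insert i J)
  have "gram_on S (\<lambda>x y.
      a i x y * ((\<Prod>j\<in>J. a j x y + b j x y + c j x y) + (\<Prod>j\<in>J. a j x y)
        - (\<Prod>j\<in>J. a j x y + b j x y) - (\<Prod>j\<in>J. a j x y + c j x y))
    + b i x y * ((\<Prod>j\<in>J. b j x y + a j x y + c j x y) + (\<Prod>j\<in>J. b j x y)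
        - (\<Prod>j\<in>J. b j x y + a j x y) - (\<Prod>j\<in>J. b j x y + c j x y))
    + c i x y * ((\<Prod>j\<in>J. c j x y + a j x y + b j x y) + (\<Prod>j\<in>J. c j x y)
        - (\<Prod>j\<in>J. c j x y + a j x y) - (\<Prod>j\<in>J. c j x y + b j x y)))"
    using insert by (intro gram_on_add gram_on_mult gram_on_prod_superadditive) auto
  then show ?case by (rule gram_on_cong) (simp add: insert.hyps algebra_simps)
\<comment> \<open>For empty or infinite \<open>J\<close> all seven products are 1, and the
  combination is 4 - 3 = 1 rather than 0.\<close>
qed (simp_all add: gram_on_one)

section \<open>Positive semidefinite matrices\<close>

lemma mat_adjoint_carrier:
  "A \<in> carrier_mat k l \<Longrightarrow> mat_adjoint A \<in> carrier_mat l k"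
  unfolding mat_adjoint_def by auto

lemma mat_adjoint_index:
  fixes A :: "complex mat"
  assumes "A \<in> carrier_mat k l" and "i < l" and "j < k"
  shows "mat_adjoint A $$ (i, j) = cnj (A $$ (j, i))"
  using assms unfolding mat_adjoint_def by (simp add: mat_of_rows_index)

lemma mult_mat_index:
  assumes "A \<in> carrier_mat k l" and "B \<in> carrier_mat l h" and "i < k" and "j < h"
  shows "(A * B) $$ (i, j) = (\<Sum>x<l. A $$ (i, x) * B $$ (x, j))"
  using assms by (simp add: scalar_prod_def atLeast0LessThan)

lemma quadratic_form_eq_sum:
  fixes A :: "complex mat"
  assumes "A \<in> carrier_mat k k" and "v \<in> carrier_vec k"
  shows "(A *\<^sub>v v) \<bullet>c v = (\<Sum>x<k. \<Sum>y<k. cnj (v $ x) * A $$ (x, y) * v $ y)"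
  using assms
  by (simp add: scalar_prod_def atLeast0LessThan sum_distrib_left sum_distrib_right mult_ac)

lemma positive_semidefinite_imp_gram_on:
  assumes "positive_semidefinite k A"
  shows "gram_on {..<k} (\<lambda>x y. A $$ (x, y))"
proof (rule psd_on_imp_gram_on)
  have A: "A \<in> carrier_mat k k" and adj: "mat_adjoint A = A"
    and pos: "\<And>v. v \<in> carrier_vec k \<Longrightarrow> 0 \<le> (A *\<^sub>v v) \<bullet>c v"
    using assms unfolding positive_semidefinite_def hermitian_mat_def by auto
  show "psd_on {..<k} (\<lambda>x y. A $$ (x, y))"
    unfolding psd_on_def
  proof (intro conjI ballI allI)
    fix x y assume "x \<in> {..<k}" "y \<in> {..<k}"
    then show "A $$ (y, x) = cnj (A $$ (x, y))"
      using mat_adjoint_index[OF A, of y x] adj by simp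
  next
    fix c :: "nat \<Rightarrow> complex"
    show "0 \<le> (\<Sum>x<k. \<Sum>y<k. cnj (c x) * A $$ (x, y) * c y)"
      using pos[of "vec k c"] by (simp add: quadratic_form_eq_sum[OF A])
  qed
qed simp

lemma gram_on_imp_hermitian_mat:
  assumes A: "A \<in> carrier_mat k k" and gram: "gram_on {..<k} (\<lambda>x y. A $$ (x, y))"
  shows "hermitian_mat k A"
  unfolding hermitian_mat_def
proof
  show "mat_adjoint A = A"
  proof (rule eq_matI)
    fix i j assume "i < dim_row A" "j < dim_col A"
    then have "i < k" "j < k" using A by auto
    then show "mat_adjoint A $$ (i, j) = A $$ (i, j)"
      using gram_on_hermitian[OF gram, of j i] mat_adjoint_index[OF A, of i j] by simp
  qed (use mat_adjoint_carrier[OF A] A in auto)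
qed (rule A)

lemma gram_on_imp_positive_semidefinite:
  assumes A: "A \<in> carrier_mat k k" and gram: "gram_on {..<k} (\<lambda>x y. A $$ (x, y))"
  shows "positive_semidefinite k A"
  unfolding positive_semidefinite_def
  using gram_on_imp_hermitian_mat[OF assms] gram_on_nonneg[OF gram]
  by (simp add: quadratic_form_eq_sum[OF A])

text \<open>The kernels of \<open>X\<close> and \<open>Y\<close> give the Hermitian property that
  the order demands of each side; the difference gives the inequality itself.\<close>

lemma gram_on_imp_loewner_ge:
  assumes X: "X \<in> carrier_mat k k" "gram_on {..<k} (\<lambda>x y. X $$ (x, y))"
    and Y: "Y \<in> carrier_mat k k" "gram_on {..<k} (\<lambda>x y. Y $$ (x, y))"
    and diff: "gram_on {..<k} (\<lambda>x y. X $$ (x, y) - Y $$ (x, y))"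
  shows "loewner_ge k X Y"
  unfolding loewner_ge_def
proof (intro conjI gram_on_imp_hermitian_mat gram_on_imp_positive_semidefinite)
  show "gram_on {..<k} (\<lambda>x y. (X - Y) $$ (x, y))"
    using diff by (rule gram_on_cong) (use X Y in auto)
qed (use X Y in auto)

section \<open>Characters are positive definite\<close>

lemma representation_carrier:
  assumes "representation H d \<rho>" and "g \<in> carrier H"
  shows "\<rho> g \<in> carrier_mat d d"
  using hom_in_carrier[of \<rho> H "units_of (ring_mat TYPE(complex) d ())" g] assms
  unfolding representation_def units_of_def Units_def ring_mat_def by auto

lemma representation_mult:
  assumes "representation H d \<rho>" and "g \<in> carrier H" and "h \<in> carrier H"
  shows "\<rho> (g \<otimes>\<^bsub>H\<^esub> h) = \<rho> g * \<rho> h"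
  using hom_mult[of \<rho> H "units_of (ring_mat TYPE(complex) d ())"] assms
  unfolding representation_def by (simp add: units_of_mult ring_mat_simps)

lemma representation_one:
  assumes "representation H d \<rho>" and "group H"
  shows "\<rho> \<one>\<^bsub>H\<^esub> = 1\<^sub>m d"
proof -
  interpret R: ring "ring_mat TYPE(complex) d ()" by (rule ring_mat)
  have "\<rho> \<one>\<^bsub>H\<^esub> = \<one>\<^bsub>units_of (ring_mat TYPE(complex) d ())\<^esub>"
    using assms R.units_group unfolding representation_def by (intro hom_one)
  then show ?thesis by (simp add: units_of_one ring_mat_simps)
qed

text \<open>The Gram matrix of the inner product obtained by averaging over the group.\<close>

definition invariant_form :: "('g, 'b) monoid_scheme \<Rightarrow> nat \<Rightarrow> ('g \<Rightarrow> complex mat) \<Rightarrow> complex mat" where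
  "invariant_form H d \<rho> = mat d d (\<lambda>(i, j).
     \<Sum>g\<in>carrier H. \<Sum>e<d. cnj (\<rho> g $$ (e, i)) * \<rho> g $$ (e, j))"

lemma invariant_form_carrier: "invariant_form H d \<rho> \<in> carrier_mat d d"
  unfolding invariant_form_def by simp

lemma invariant_form_gram_on:
  "gram_on {..<d} (\<lambda>x y. invariant_form H d \<rho> $$ (x, y))"
proof -
  have "gram_on {..<d} (\<lambda>i j. \<Sum>g\<in>carrier H. \<Sum>e<d. cnj (\<rho> g $$ (e, i)) * cnj (cnj (\<rho> g $$ (e, j))))"
    by (intro gram_on_sum gram_on_rank_one)
  then show ?thesis by (rule gram_on_cong) (simp add: invariant_form_def)
qed

text \<open>Conjugating by \<open>\<rho> h\<close> replaces each summand for \<open>g\<close> by the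
  one for the product of \<open>g\<close> and \<open>h\<close>, and right translation by
  \<open>h\<close> permutes the group.\<close>

lemma invariant_form_invariant:
  assumes rep: "representation H d \<rho>" and grp: "group H" and h: "h \<in> carrier H"
  shows "mat_adjoint (\<rho> h) * invariant_form H d \<rho> * \<rho> h = invariant_form H d \<rho>"
proof (rule eq_matI)
  interpret group H by (rule grp)
  let ?P = "invariant_form H d \<rho>"
  note car = representation_carrier[OF rep]
  fix i j assume "i < dim_row ?P" "j < dim_col ?P"
  then have ij: "i < d" "j < d" using invariant_form_carrier[of H d \<rho>] by auto
  have "(mat_adjoint (\<rho> h) * ?P * \<rho> h) $$ (i, j)
      = (\<Sum>y<d. (\<Sum>x<d. cnj (\<rho> h $$ (x, i)) * ?P $$ (x, y)) * \<rho> h $$ (y, j))"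
    using ij car[OF h] invariant_form_carrier[of H d \<rho>]
    by (subst mult_mat_index[of _ d d _ d])
       (auto intro!: sum.cong mult_carrier_mat mat_adjoint_carrier
         simp: mult_mat_index[of "mat_adjoint (\<rho> h)" d d _ d] mat_adjoint_carrier
           mat_adjoint_index[OF car[OF h]] simp del: index_mult_mat)
  \<comment> \<open>The swaps move \<open>g\<close> and \<open>e\<close> outermost; the sums over
    \<open>x\<close> and \<open>y\<close> then become entries of the product of
    \<open>\<rho> g\<close> and \<open>\<rho> h\<close>.\<close>
  also have "\<dots> = (\<Sum>y<d. \<Sum>x<d. \<Sum>g\<in>carrier H. \<Sum>e<d.
      cnj (\<rho> h $$ (x, i)) * cnj (\<rho> g $$ (e, x)) * \<rho> g $$ (e, y) * \<rho> h $$ (y, j))"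
    by (simp add: invariant_form_def sum_distrib_left sum_distrib_right mult_ac)
  also have "\<dots> = (\<Sum>y<d. \<Sum>g\<in>carrier H. \<Sum>x<d. \<Sum>e<d.
      cnj (\<rho> h $$ (x, i)) * cnj (\<rho> g $$ (e, x)) * \<rho> g $$ (e, y) * \<rho> h $$ (y, j))"
    by (intro sum.cong refl sum.swap)
  also have "\<dots> = (\<Sum>g\<in>carrier H. \<Sum>y<d. \<Sum>x<d. \<Sum>e<d.
      cnj (\<rho> h $$ (x, i)) * cnj (\<rho> g $$ (e, x)) * \<rho> g $$ (e, y) * \<rho> h $$ (y, j))"
    by (rule sum.swap)
  also have "\<dots> = (\<Sum>g\<in>carrier H. \<Sum>y<d. \<Sum>e<d. \<Sum>x<d.
      cnj (\<rho> h $$ (x, i)) * cnj (\<rho> g $$ (e, x)) * \<rho> g $$ (e, y) * \<rho> h $$ (y, j))"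
    by (intro sum.cong refl sum.swap)
  also have "\<dots> = (\<Sum>g\<in>carrier H. \<Sum>e<d. \<Sum>y<d. \<Sum>x<d.
      cnj (\<rho> h $$ (x, i)) * cnj (\<rho> g $$ (e, x)) * \<rho> g $$ (e, y) * \<rho> h $$ (y, j))"
    by (intro sum.cong refl sum.swap)
  also have "\<dots> = (\<Sum>g\<in>carrier H. \<Sum>e<d. \<Sum>x<d. \<Sum>y<d.
      cnj (\<rho> h $$ (x, i)) * cnj (\<rho> g $$ (e, x)) * \<rho> g $$ (e, y) * \<rho> h $$ (y, j))"
    by (intro sum.cong refl sum.swap)
  also have "\<dots> = (\<Sum>g\<in>carrier H. \<Sum>e<d.
      cnj (\<Sum>x<d. \<rho> g $$ (e, x) * \<rho> h $$ (x, i)) * (\<Sum>y<d. \<rho> g $$ (e, y) * \<rho> h $$ (y, j)))"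
    unfolding cnj_sum sum_product by (simp add: mult_ac)
  also have "\<dots> = (\<Sum>g\<in>carrier H. \<Sum>e<d.
      cnj (\<rho> (g \<otimes>\<^bsub>H\<^esub> h) $$ (e, i)) * \<rho> (g \<otimes>\<^bsub>H\<^esub> h) $$ (e, j))"
    using ij h car
    by (intro sum.cong refl) (simp add: representation_mult[OF rep] mult_mat_index[of _ d d _ d]
        del: index_mult_mat)
  also have "\<dots> = (\<Sum>g\<in>carrier H. \<Sum>e<d. cnj (\<rho> g $$ (e, i)) * \<rho> g $$ (e, j))"
    by (rule sum.reindex_bij_witness[where i = "\<lambda>g. g \<otimes>\<^bsub>H\<^esub> inv\<^bsub>H\<^esub> h" and j = "\<lambda>g. g \<otimes>\<^bsub>H\<^esub> h"])
       (use h in \<open>auto simp: m_assoc\<close>)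
  also have "\<dots> = ?P $$ (i, j)"
    using ij by (simp add: invariant_form_def)
  finally show "(mat_adjoint (\<rho> h) * ?P * \<rho> h) $$ (i, j) = ?P $$ (i, j)" .
qed (use representation_carrier[OF rep h] mat_adjoint_carrier invariant_form_carrier[of H d \<rho>]
      in auto)

text \<open>If \<open>?P\<close> kills \<open>v\<close>, then the sum over \<open>g\<close> of the
  squared norms of \<open>\<rho> g *\<^sub>v v\<close> is 0. The term of the group identity forces
  \<open>v\<close> to vanish, so the determinant is nonzero.\<close>

lemma invariant_form_invertible:
  assumes rep: "representation H d \<rho>" and grp: "group H" and fin: "finite (carrier H)"
  obtains N where "N \<in> carrier_mat d d" and "N * invariant_form H d \<rho> = 1\<^sub>m d"
    and "invariant_form H d \<rho> * N = 1\<^sub>m d"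
proof -
  interpret group H by (rule grp)
  let ?P = "invariant_form H d \<rho>"
  have P: "?P \<in> carrier_mat d d" by (rule invariant_form_carrier)
  have "v = 0\<^sub>v d" if v: "v \<in> carrier_vec d" and Pv: "?P *\<^sub>v v = 0\<^sub>v d" for v
  proof -
    define u where "u = (\<lambda>g e. \<Sum>y<d. \<rho> g $$ (e, y) * v $ y)"
    have "0 = (\<Sum>x<d. \<Sum>y<d. cnj (v $ x) * ?P $$ (x, y) * v $ y)"
      using quadratic_form_eq_sum[OF P v] v by (simp add: Pv)
    also have "\<dots> = (\<Sum>x<d. \<Sum>y<d. \<Sum>g\<in>carrier H. \<Sum>e<d.
        cnj (v $ x) * cnj (\<rho> g $$ (e, x)) * \<rho> g $$ (e, y) * v $ y)"
      by (simp add: invariant_form_def sum_distrib_left sum_distrib_right mult_ac)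
    also have "\<dots> = (\<Sum>x<d. \<Sum>g\<in>carrier H. \<Sum>y<d. \<Sum>e<d.
        cnj (v $ x) * cnj (\<rho> g $$ (e, x)) * \<rho> g $$ (e, y) * v $ y)"
      by (intro sum.cong refl sum.swap)
    also have "\<dots> = (\<Sum>g\<in>carrier H. \<Sum>x<d. \<Sum>y<d. \<Sum>e<d.
        cnj (v $ x) * cnj (\<rho> g $$ (e, x)) * \<rho> g $$ (e, y) * v $ y)"
      by (rule sum.swap)
    also have "\<dots> = (\<Sum>g\<in>carrier H. \<Sum>x<d. \<Sum>e<d. \<Sum>y<d.
        cnj (v $ x) * cnj (\<rho> g $$ (e, x)) * \<rho> g $$ (e, y) * v $ y)"
      by (intro sum.cong refl sum.swap)
    also have "\<dots> = (\<Sum>g\<in>carrier H. \<Sum>e<d. \<Sum>x<d. \<Sum>y<d.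
        cnj (v $ x) * cnj (\<rho> g $$ (e, x)) * \<rho> g $$ (e, y) * v $ y)"
      by (intro sum.cong refl sum.swap)
    also have "\<dots> = (\<Sum>g\<in>carrier H. \<Sum>e<d. cnj (u g e) * u g e)"
      unfolding u_def cnj_sum sum_product by (simp add: mult_ac)
    also have "\<dots> = complex_of_real (\<Sum>g\<in>carrier H. \<Sum>e<d. (cmod (u g e))\<^sup>2)"
      by (simp add: complex_norm_square mult_ac del: of_real_power)
    finally have "(\<Sum>g\<in>carrier H. \<Sum>e<d. (cmod (u g e))\<^sup>2) = 0"
      using of_real_eq_0_iff by metis
    then have "(\<Sum>e<d. (cmod (u \<one>\<^bsub>H\<^esub> e))\<^sup>2) = 0"
      using fin by (subst (asm) sum_nonneg_eq_0_iff) (auto intro: sum_nonneg)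
    then have u0: "u \<one>\<^bsub>H\<^esub> e = 0" if "e < d" for e
      using that by (subst (asm) sum_nonneg_eq_0_iff) auto
    have "u \<one>\<^bsub>H\<^esub> e = v $ e" if "e < d" for e
    proof -
      have "u \<one>\<^bsub>H\<^esub> e = (\<Sum>y<d. (if y = e then v $ e else 0))"
        unfolding u_def representation_one[OF rep grp] by (intro sum.cong) (use that in auto)
      then show ?thesis using that by simp
    qed
    then show ?thesis using u0 v by (intro eq_vecI) auto
  qed
  then have "det ?P \<noteq> 0"
    using det_0_iff_vec_prod_zero[OF P] by blast
  from det_non_zero_imp_unit[OF P this, of "()"] obtain N where
    "N \<in> carrier_mat d d" "N * ?P = 1\<^sub>m d" "?P * N = 1\<^sub>m d"
    unfolding Units_def ring_mat_def by auto
  then show ?thesis by (rule that)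
qed

lemma mat_adjoint_mult:
  fixes A B :: "complex mat"
  assumes A: "A \<in> carrier_mat k l" and B: "B \<in> carrier_mat l h"
  shows "mat_adjoint (A * B) = mat_adjoint B * mat_adjoint A"
proof (rule eq_matI)
  note adj = mat_adjoint_carrier[OF A] mat_adjoint_carrier[OF B]
  fix i j assume "i < dim_row (mat_adjoint B * mat_adjoint A)"
    "j < dim_col (mat_adjoint B * mat_adjoint A)"
  then have ij: "i < h" "j < k" using adj by auto
  show "mat_adjoint (A * B) $$ (i, j) = (mat_adjoint B * mat_adjoint A) $$ (i, j)"
    using ij adj A B
    by (subst mult_mat_index[OF adj(2,1)])
       (simp_all add: mat_adjoint_index[of _ k h] mat_adjoint_index[OF A] mat_adjoint_index[OF B]
         mult_mat_index[OF A B] mult_ac del: index_mult_mat)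
qed (use mat_adjoint_carrier[OF A] mat_adjoint_carrier[OF B]
      mat_adjoint_carrier[OF mult_carrier_mat[OF A B]] in auto)

text \<open>\<open>N = N P N\<close> with \<open>N\<close> Hermitian, so \<open>N\<close> is a congruence transform of \<open>P\<close>.\<close>

lemma inverse_gram_on:
  assumes P: "P \<in> carrier_mat d d" and gram: "gram_on {..<d} (\<lambda>x y. P $$ (x, y))"
    and N: "N \<in> carrier_mat d d" and NP: "N * P = 1\<^sub>m d" and PN: "P * N = 1\<^sub>m d"
  shows "gram_on {..<d} (\<lambda>x y. N $$ (x, y))"
proof -
  have adjP: "mat_adjoint P = P"
    using gram_on_imp_hermitian_mat[OF P gram] unfolding hermitian_mat_def by simp
  have adj1: "mat_adjoint (1\<^sub>m d :: complex mat) = 1\<^sub>m d"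
    by (rule eq_matI) (use mat_adjoint_carrier[of "1\<^sub>m d" d d] in \<open>auto simp: mat_adjoint_index[of _ d d]\<close>)
  let ?X = "mat_adjoint N"
  have X: "?X \<in> carrier_mat d d" by (rule mat_adjoint_carrier[OF N])
  \<comment> \<open>The adjoint of \<open>N\<close> is a left inverse of the Hermitian
    \<open>P\<close>, hence equals \<open>N\<close>.\<close>
  have "?X * P = 1\<^sub>m d"
    using mat_adjoint_mult[OF P N] by (simp add: PN adjP adj1)
  then have "?X = N"
    using assoc_mult_mat[OF X P N] X N by (simp add: PN)
  then have herm: "N $$ (e, b) = cnj (N $$ (b, e))" if "e < d" "b < d" for e b
    using mat_adjoint_index[OF N that] by simp
  have "gram_on ({..<d} \<times> {..<d})
      (\<lambda>x y. N $$ x * cnj (N $$ y) * P $$ (snd x, snd y))"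
    by (intro gram_on_mult gram_on_rank_one gram_on_pullback[OF gram]) auto
  from gram_on_marginal[OF this]
  show ?thesis
  proof (rule gram_on_cong)
    fix a b assume ab: "a \<in> {..<d}" "b \<in> {..<d}"
    have "N $$ (a, b) = (N * (P * N)) $$ (a, b)"
      using N by (simp add: PN)
    also have "\<dots> = (\<Sum>c<d. N $$ (a, c) * (\<Sum>e<d. P $$ (c, e) * N $$ (e, b)))"
      using ab P N by (simp add: mult_mat_index[of _ d d _ d] del: index_mult_mat)
    also have "\<dots> = (\<Sum>c<d. \<Sum>e<d. N $$ (a, c) * cnj (N $$ (b, e)) * P $$ (c, e))"
      using ab herm[of _ b] by (simp add: sum_distrib_left mult_ac)
    finally show "(\<Sum>u<d. \<Sum>v<d. N $$ (a, u) * cnj (N $$ (b, v)) * P $$ (snd (a, u), snd (b, v)))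
        = N $$ (a, b)" by simp
  qed
qed

text \<open>Writing the inverse through the adjoint turns the trace into a fourfold sum in which
  \<open>\<tau>\<close> enters only through conjugated entries of \<open>\<rho> \<tau>\<close> and
  \<open>\<sigma>\<close> only through entries of \<open>\<rho> \<sigma>\<close>. The weights are
  entries of the Gram kernels of \<open>P\<close> and \<open>N\<close>.\<close>

lemma character_gram_on:
  assumes rep: "representation H d \<rho>" and grp: "group H" and fin: "finite (carrier H)"
  shows "gram_on (carrier H) (\<lambda>\<tau> \<sigma>. \<Sum>a<d. \<rho> (\<sigma> \<otimes>\<^bsub>H\<^esub> inv\<^bsub>H\<^esub> \<tau>) $$ (a, a))"
proof -
  interpret group H by (rule grp)
  define P where "P = invariant_form H d \<rho>"
  have P: "P \<in> carrier_mat d d" unfolding P_def by (rule invariant_form_carrier)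
  obtain N where N: "N \<in> carrier_mat d d" and NP: "N * P = 1\<^sub>m d" and PN: "P * N = 1\<^sub>m d"
    unfolding P_def by (rule invariant_form_invertible[OF rep grp fin])
  have gramP: "gram_on {..<d} (\<lambda>x y. P $$ (x, y))"
    unfolding P_def by (rule invariant_form_gram_on)
  have gramN: "gram_on {..<d} (\<lambda>x y. N $$ (y, x))"
    by (rule gram_on_transpose[OF inverse_gram_on[OF P gramP N NP PN]])
  note car = representation_carrier[OF rep]
  \<comment> \<open>Invariance says that \<open>\<rho> \<tau>\<close> is unitary for the form
    \<open>P\<close>; multiplying by the inverse on the right and by \<open>N\<close> on the left
    isolates it.\<close>
  have rinv: "\<rho> (inv\<^bsub>H\<^esub> \<tau>) = N * (mat_adjoint (\<rho> \<tau>) * P)" if \<tau>: "\<tau> \<in> carrier H" for \<tau>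
  proof -
    have R: "\<rho> \<tau> \<in> carrier_mat d d" and R': "\<rho> (inv\<^bsub>H\<^esub> \<tau>) \<in> carrier_mat d d"
      using \<tau> car by auto
    have adjR: "mat_adjoint (\<rho> \<tau>) \<in> carrier_mat d d" by (rule mat_adjoint_carrier[OF R])
    have adjRP: "mat_adjoint (\<rho> \<tau>) * P \<in> carrier_mat d d" using adjR P by simp
    have "\<rho> \<tau> * \<rho> (inv\<^bsub>H\<^esub> \<tau>) = 1\<^sub>m d"
      using \<tau> representation_mult[OF rep \<tau>, of "inv\<^bsub>H\<^esub> \<tau>"] representation_one[OF rep grp]
      by simp
    then have "mat_adjoint (\<rho> \<tau>) * P = mat_adjoint (\<rho> \<tau>) * P * (\<rho> \<tau> * \<rho> (inv\<^bsub>H\<^esub> \<tau>))"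
      using right_mult_one_mat[OF adjRP] by simp
    also have "\<dots> = P * \<rho> (inv\<^bsub>H\<^esub> \<tau>)"
      using assoc_mult_mat[OF adjRP R R'] invariant_form_invariant[OF rep grp \<tau>]
      by (simp add: P_def)
    finally have "N * (mat_adjoint (\<rho> \<tau>) * P) = N * (P * \<rho> (inv\<^bsub>H\<^esub> \<tau>))" by simp
    also have "\<dots> = \<rho> (inv\<^bsub>H\<^esub> \<tau>)"
      using assoc_mult_mat[OF N P R'] NP R' by simp
    finally show ?thesis by simp
  qed
  let ?T = "{..<d} \<times> {..<d}"
  \<comment> \<open>The summed indices are pairs: \<open>(e, c)\<close> beside \<open>\<tau>\<close>
    and \<open>(a, b)\<close> beside \<open>\<sigma>\<close>. The trace contributes
    \<open>N $$ (b, c)\<close>, which explains the transposed kernel of \<open>N\<close>.\<close>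
  have "gram_on (carrier H \<times> ?T) (\<lambda>x y. cnj (\<rho> (fst x) $$ snd x) * cnj (cnj (\<rho> (fst y) $$ snd y))
      * P $$ (fst (snd x), fst (snd y)) * N $$ (snd (snd y), snd (snd x)))"
    by (intro gram_on_mult gram_on_rank_one gram_on_pullback[OF gramP] gram_on_pullback[OF gramN])
       auto
  from gram_on_marginal[OF this]
  show ?thesis
  proof (rule gram_on_cong)
    fix \<tau> \<sigma> assume \<tau>: "\<tau> \<in> carrier H" and \<sigma>: "\<sigma> \<in> carrier H"
    have "(\<Sum>a<d. \<rho> (\<sigma> \<otimes>\<^bsub>H\<^esub> inv\<^bsub>H\<^esub> \<tau>) $$ (a, a))
        = (\<Sum>a<d. \<Sum>b<d. \<rho> \<sigma> $$ (a, b) * (\<Sum>c<d. N $$ (b, c) *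
            (\<Sum>e<d. cnj (\<rho> \<tau> $$ (e, c)) * P $$ (e, a))))"
    proof (intro sum.cong refl)
      fix a assume "a \<in> {..<d}"
      have adjR: "mat_adjoint (\<rho> \<tau>) \<in> carrier_mat d d"
        by (rule mat_adjoint_carrier[OF car[OF \<tau>]])
      have "\<rho> (\<sigma> \<otimes>\<^bsub>H\<^esub> inv\<^bsub>H\<^esub> \<tau>) = \<rho> \<sigma> * (N * (mat_adjoint (\<rho> \<tau>) * P))"
        using representation_mult[OF rep \<sigma>, of "inv\<^bsub>H\<^esub> \<tau>"] rinv[OF \<tau>] \<tau> by simp
      then show "\<rho> (\<sigma> \<otimes>\<^bsub>H\<^esub> inv\<^bsub>H\<^esub> \<tau>) $$ (a, a) = (\<Sum>b<d. \<rho> \<sigma> $$ (a, b) *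
          (\<Sum>c<d. N $$ (b, c) * (\<Sum>e<d. cnj (\<rho> \<tau> $$ (e, c)) * P $$ (e, a))))"
        using \<open>a \<in> {..<d}\<close> adjR N P car[OF \<sigma>]
        by (simp add: mult_mat_index[of _ d d _ d] mat_adjoint_index[OF car[OF \<tau>]]
            del: index_mult_mat)
    qed
    also have "\<dots> = (\<Sum>a<d. \<Sum>b<d. \<Sum>c<d. \<Sum>e<d. cnj (\<rho> \<tau> $$ (e, c)) * \<rho> \<sigma> $$ (a, b)
        * P $$ (e, a) * N $$ (b, c))"
      by (simp add: sum_distrib_left mult_ac)
    also have "\<dots> = (\<Sum>a<d. \<Sum>b<d. \<Sum>e<d. \<Sum>c<d. cnj (\<rho> \<tau> $$ (e, c)) * \<rho> \<sigma> $$ (a, b)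
        * P $$ (e, a) * N $$ (b, c))"
      by (intro sum.cong refl sum.swap)
    also have "\<dots> = (\<Sum>v\<in>?T. \<Sum>u\<in>?T. cnj (\<rho> \<tau> $$ u) * \<rho> \<sigma> $$ v
        * P $$ (fst u, fst v) * N $$ (snd v, snd u))"
      by (simp add: sum.cartesian_product')
    also have "\<dots> = (\<Sum>u\<in>?T. \<Sum>v\<in>?T. cnj (\<rho> \<tau> $$ u) * \<rho> \<sigma> $$ v
        * P $$ (fst u, fst v) * N $$ (snd v, snd u))"
      by (rule sum.swap)
    finally show "(\<Sum>u\<in>?T. \<Sum>v\<in>?T. cnj (\<rho> (fst (\<tau>, u)) $$ snd (\<tau>, u))
        * cnj (cnj (\<rho> (fst (\<sigma>, v)) $$ snd (\<sigma>, v)))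
        * P $$ (fst (snd (\<tau>, u)), fst (snd (\<sigma>, v)))
        * N $$ (snd (snd (\<sigma>, v)), snd (snd (\<tau>, u))))
        = (\<Sum>a<d. \<rho> (\<sigma> \<otimes>\<^bsub>H\<^esub> inv\<^bsub>H\<^esub> \<tau>) $$ (a, a))"
      by simp
  qed
qed

lemma irreducible_character_gram_on:
  assumes "irreducible_character H \<chi>" and grp: "group H" and fin: "finite (carrier H)"
  shows "gram_on (carrier H) (\<lambda>\<tau> \<sigma>. \<chi> (\<sigma> \<otimes>\<^bsub>H\<^esub> inv\<^bsub>H\<^esub> \<tau>))"
proof -
  interpret group H by (rule grp)
  obtain d \<rho> where irr: "irreducible_representation H d \<rho>"
    and \<chi>: "\<forall>g\<in>carrier H. \<chi> g = (\<Sum>i<d. \<rho> g $$ (i, i))"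
    using assms(1) unfolding irreducible_character_def by (elim exE conjE)
  have rep: "representation H d \<rho>"
    using irr unfolding irreducible_representation_def by (rule conjunct1)
  show ?thesis
    using character_gram_on[OF rep grp fin] by (rule gram_on_cong) (simp add: \<chi>)
qed

section \<open>Partial generalized matrix functions\<close>

text \<open>The map \<open>\<phi>\<close> sends a position \<open>p\<close> of the result and a
  position \<open>i\<close> of the permuted index to an index of the large matrix. The two partial
  functions differ only in \<open>\<phi>\<close>.\<close>

definition gmf_kernel :: "(nat \<Rightarrow> nat) set \<Rightarrow> ((nat \<Rightarrow> nat) \<Rightarrow> complex) \<Rightarrow> nat \<Rightarrow> ('s \<Rightarrow> nat \<Rightarrow> 'a) \<Rightarrow>
    ('a \<Rightarrow> 'a \<Rightarrow> complex) \<Rightarrow> 's \<Rightarrow> 's \<Rightarrow> complex" where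
  "gmf_kernel G \<chi> k \<phi> F p q = (\<Sum>\<sigma>\<in>G. \<chi> \<sigma> * (\<Prod>i = 1..k. F (\<phi> p i) (\<phi> q (\<sigma> i))))"

text \<open>Summing over an extra right translation by \<open>\<tau>\<close> turns the single sum over \<open>G\<close> into the
  marginal of the product of \<open>W\<close> with the positive definite kernel \<open>\<chi> (\<sigma> \<tau>\<inverse>)\<close>.\<close>

lemma character_sum_gram_on:
  assumes sub: "subgroup G (sym_group k)"
    and char: "irreducible_character ((sym_group k)\<lparr>carrier := G\<rparr>) \<chi>"
    and gram: "gram_on (S \<times> G) (\<lambda>x y. W (fst x) (snd x) (fst y) (snd y))"
    and inv: "\<And>p q \<tau> \<sigma>. \<tau> \<in> G \<Longrightarrow> \<sigma> \<in> G \<Longrightarrow> W p \<tau> q (\<sigma> \<circ> \<tau>) = W p id q \<sigma>"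
  shows "gram_on S (\<lambda>p q. \<Sum>\<sigma>\<in>G. \<chi> \<sigma> * W p id q \<sigma>)"
proof -
  let ?H = "(sym_group k)\<lparr>carrier := G\<rparr>"
  have perm: "\<sigma> permutes {1..k}" if "\<sigma> \<in> G" for \<sigma>
    using subgroup.subset[OF sub] that by (auto simp: sym_group_def)
  have fin: "finite G"
    by (rule finite_subset[of _ "{p. p permutes {1..k}}"]) (use perm finite_permutations in auto)
  have grp: "group ?H"
    by (rule subgroup.subgroup_is_group[OF sub sym_group_is_group])
  interpret H: group ?H by (rule grp)
  have ne: "card G > 0"
    using fin subgroup.one_closed[OF sub] by (auto simp: card_gt_0_iff)
  have "gram_on G (\<lambda>\<tau> \<sigma>. \<chi> (\<sigma> \<otimes>\<^bsub>?H\<^esub> inv\<^bsub>?H\<^esub> \<tau>))"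
    using irreducible_character_gram_on[OF char grp] fin by simp
  then have "gram_on (S \<times> G) (\<lambda>x y. \<chi> (snd y \<otimes>\<^bsub>?H\<^esub> inv\<^bsub>?H\<^esub> (snd x)) * W (fst x) (snd x) (fst y) (snd y))"
    by (intro gram_on_mult gram gram_on_pullback[where \<phi> = snd]) auto
  from gram_on_scale[OF gram_on_marginal[OF this], of "1 / real (card G)"]
  show ?thesis
  proof (rule gram_on_cong)
    fix p q
    \<comment> \<open>Replacing \<open>\<sigma>\<close> by its product with the inverse of
      \<open>\<tau>\<close> shows that the inner sum does not depend on \<open>\<tau>\<close>. The
      factor \<open>1 / real (card G)\<close> cancels the number of equal sums.\<close>
    have "(\<Sum>\<sigma>\<in>G. \<chi> (\<sigma> \<otimes>\<^bsub>?H\<^esub> inv\<^bsub>?H\<^esub> \<tau>) * W p \<tau> q \<sigma>) = (\<Sum>\<sigma>\<in>G. \<chi> \<sigma> * W p id q \<sigma>)"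
      if \<tau>: "\<tau> \<in> G" for \<tau>
    proof (rule sum.reindex_bij_witness[where i = "\<lambda>\<sigma>. \<sigma> \<otimes>\<^bsub>?H\<^esub> \<tau>" and j = "\<lambda>\<sigma>. \<sigma> \<otimes>\<^bsub>?H\<^esub> inv\<^bsub>?H\<^esub> \<tau>"])
      fix \<sigma> assume \<sigma>: "\<sigma> \<in> G"
      have \<tau>': "inv\<^bsub>?H\<^esub> \<tau> \<in> G" using H.inv_closed[of \<tau>] \<tau> by simp
      show closed: "\<sigma> \<otimes>\<^bsub>?H\<^esub> inv\<^bsub>?H\<^esub> \<tau> \<in> G" using H.m_closed[of \<sigma> "inv\<^bsub>?H\<^esub> \<tau>"] \<sigma> \<tau>' by simp
      show "\<sigma> \<otimes>\<^bsub>?H\<^esub> \<tau> \<in> G" using H.m_closed[of \<sigma> \<tau>] \<sigma> \<tau> by simp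
      show cancel: "(\<sigma> \<otimes>\<^bsub>?H\<^esub> inv\<^bsub>?H\<^esub> \<tau>) \<otimes>\<^bsub>?H\<^esub> \<tau> = \<sigma>"
        using H.m_assoc[of \<sigma> "inv\<^bsub>?H\<^esub> \<tau>" \<tau>] H.l_inv[of \<tau>] H.r_one[of \<sigma>] \<sigma> \<tau> \<tau>' by simp
      show "(\<sigma> \<otimes>\<^bsub>?H\<^esub> \<tau>) \<otimes>\<^bsub>?H\<^esub> inv\<^bsub>?H\<^esub> \<tau> = \<sigma>"
        using H.m_assoc[of \<sigma> \<tau> "inv\<^bsub>?H\<^esub> \<tau>"] H.r_inv[of \<tau>] H.r_one[of \<sigma>] \<sigma> \<tau> \<tau>' by simp
      have "W p \<tau> q \<sigma> = W p id q (\<sigma> \<otimes>\<^bsub>?H\<^esub> inv\<^bsub>?H\<^esub> \<tau>)"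
        using inv[OF \<tau> closed, of p q] cancel by (simp add: sym_group_mult)
      then show "\<chi> (\<sigma> \<otimes>\<^bsub>?H\<^esub> inv\<^bsub>?H\<^esub> \<tau>) * W p id q (\<sigma> \<otimes>\<^bsub>?H\<^esub> inv\<^bsub>?H\<^esub> \<tau>)
          = \<chi> (\<sigma> \<otimes>\<^bsub>?H\<^esub> inv\<^bsub>?H\<^esub> \<tau>) * W p \<tau> q \<sigma>" by (rule arg_cong[OF sym])
    qed
    then have "(\<Sum>\<tau>\<in>G. \<Sum>\<sigma>\<in>G. \<chi> (\<sigma> \<otimes>\<^bsub>?H\<^esub> inv\<^bsub>?H\<^esub> \<tau>) * W p \<tau> q \<sigma>)
        = of_nat (card G) * (\<Sum>\<sigma>\<in>G. \<chi> \<sigma> * W p id q \<sigma>)"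
      by (subst sum.cong[OF refl]) auto
    then show "complex_of_real (1 / real (card G)) * (\<Sum>u\<in>G. \<Sum>v\<in>G.
        \<chi> (snd (q, v) \<otimes>\<^bsub>?H\<^esub> inv\<^bsub>?H\<^esub> snd (p, u)) * W (fst (p, u)) (snd (p, u)) (fst (q, v)) (snd (q, v)))
        = (\<Sum>\<sigma>\<in>G. \<chi> \<sigma> * W p id q \<sigma>)"
      using ne by simp
  qed simp
qed

text \<open>The permutation \<open>\<tau>\<close> only reorders the factors. This supplies the
  translation hypothesis of \<open>character_sum_gram_on\<close>.\<close>

lemma prod_right_translate:
  assumes "\<tau> permutes {1..k}"
  shows "(\<Prod>i = 1..k. F (\<phi> p (\<tau> i)) (\<phi> q ((\<sigma> \<circ> \<tau>) i))) = (\<Prod>i = 1..k. F (\<phi> p i) (\<phi> q (\<sigma> i)))"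
  using prod.permute[OF assms, of "\<lambda>i. F (\<phi> p i) (\<phi> q (\<sigma> i))"] by (simp add: o_def)

context
  fixes G :: "(nat \<Rightarrow> nat) set" and \<chi> :: "(nat \<Rightarrow> nat) \<Rightarrow> complex" and k :: nat
    and S :: "'s set" and N :: "'a set" and \<phi> :: "'s \<Rightarrow> nat \<Rightarrow> 'a"
  assumes sub: "subgroup G (sym_group k)"
    and char: "irreducible_character ((sym_group k)\<lparr>carrier := G\<rparr>) \<chi>"
    and \<phi>: "\<And>p i. p \<in> S \<Longrightarrow> i \<in> {1..k} \<Longrightarrow> \<phi> p i \<in> N"
begin

lemma permutes_group: "\<sigma> \<in> G \<Longrightarrow> \<sigma> permutes {1..k}"
  using subgroup.subset[OF sub] by (auto simp: sym_group_def)

lemma index_group: "\<sigma> \<in> G \<Longrightarrow> p \<in> S \<Longrightarrow> i \<in> {1..k} \<Longrightarrow> \<phi> p (\<sigma> i) \<in> N"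
  using \<phi> permutes_in_image[OF permutes_group] by blast

lemma translated_kernel_gram_on:
  assumes "gram_on N F" and "i \<in> {1..k}"
  shows "gram_on (S \<times> G) (\<lambda>x y. F (\<phi> (fst x) (snd x i)) (\<phi> (fst y) (snd y i)))"
  by (rule gram_on_pullback[OF assms(1)]) (use index_group assms(2) in auto)

text \<open>On \<open>S \<times> G\<close> each factor is a pullback of \<open>F\<close>, so the
  product over \<open>i\<close> is Gram and the character sum preserves this.\<close>

lemma gmf_kernel_gram_on:
  assumes "gram_on N F"
  shows "gram_on S (gmf_kernel G \<chi> k \<phi> F)"
  unfolding gmf_kernel_def
proof -
  have "gram_on S (\<lambda>p q. \<Sum>\<sigma>\<in>G. \<chi> \<sigma> * (\<Prod>i = 1..k. F (\<phi> p (id i)) (\<phi> q (\<sigma> i))))"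
    by (rule character_sum_gram_on[OF sub char,
          where W = "\<lambda>p \<tau> q \<sigma>. \<Prod>i = 1..k. F (\<phi> p (\<tau> i)) (\<phi> q (\<sigma> i))"])
       (auto intro!: gram_on_prod translated_kernel_gram_on assms
         simp: prod_right_translate[OF permutes_group] simp del: o_apply One_nat_def)
  then show "gram_on S (\<lambda>p q. \<Sum>\<sigma>\<in>G. \<chi> \<sigma> * (\<Prod>i = 1..k. F (\<phi> p i) (\<phi> q (\<sigma> i))))"
    by simp
qed

text \<open>The character sum is linear in the products, so all seven terms are combined into one
  kernel \<open>W\<close> first; \<open>W\<close> is Gram by \<open>gram_on_prod_hlawka\<close>
  applied to the translated kernels.\<close>

lemma gmf_kernel_hlawka:
  fixes A B C :: "'a \<Rightarrow> 'a \<Rightarrow> complex"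
  assumes A: "gram_on N A" and B: "gram_on N B" and C: "gram_on N C"
  defines "\<Phi> \<equiv> gmf_kernel G \<chi> k \<phi>"
  shows "gram_on S (\<lambda>p q. \<Phi> (\<lambda>x y. A x y + B x y + C x y) p q + \<Phi> A p q + \<Phi> B p q + \<Phi> C p q
    - (\<Phi> (\<lambda>x y. A x y + B x y) p q + \<Phi> (\<lambda>x y. A x y + C x y) p q
      + \<Phi> (\<lambda>x y. B x y + C x y) p q))"
proof -
  define V where "V = (\<lambda>F p \<tau> q \<sigma>. \<Prod>i = 1..k. F (\<phi> p (\<tau> i)) (\<phi> q (\<sigma> i)) :: complex)"
  define W where "W = (\<lambda>p \<tau> q \<sigma>. V (\<lambda>x y. A x y + B x y + C x y) p \<tau> q \<sigma>
    + V A p \<tau> q \<sigma> + V B p \<tau> q \<sigma> + V C p \<tau> q \<sigma>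
    - (V (\<lambda>x y. A x y + B x y) p \<tau> q \<sigma> + V (\<lambda>x y. A x y + C x y) p \<tau> q \<sigma>
      + V (\<lambda>x y. B x y + C x y) p \<tau> q \<sigma>))"
  have inv: "V F p \<tau> q (\<sigma> \<circ> \<tau>) = V F p id q \<sigma>" if "\<tau> \<in> G" for F p \<tau> q \<sigma>
    unfolding V_def by (simp add: prod_right_translate[OF permutes_group[OF that]] del: o_apply One_nat_def)
  have \<Phi>: "\<Phi> F p q = (\<Sum>\<sigma>\<in>G. \<chi> \<sigma> * V F p id q \<sigma>)" for F p q
    by (simp add: \<Phi>_def gmf_kernel_def V_def)
  have "gram_on (S \<times> G) (\<lambda>x y. W (fst x) (snd x) (fst y) (snd y))"
    unfolding W_def V_def by (intro gram_on_prod_hlawka translated_kernel_gram_on A B C)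
  then have "gram_on S (\<lambda>p q. \<Sum>\<sigma>\<in>G. \<chi> \<sigma> * W p id q \<sigma>)"
    by (rule character_sum_gram_on[OF sub char, where W = W]) (simp only: W_def inv)
  then show ?thesis
    by (rule gram_on_cong) (simp add: W_def \<Phi> sum.distrib sum_subtractf algebra_simps)
qed

text \<open>This lets entries of matrix sums be replaced by sums of entries, an equation available
  only for indices in range.\<close>

lemma gmf_kernel_cong:
  assumes "\<And>x y. x \<in> N \<Longrightarrow> y \<in> N \<Longrightarrow> F x y = F' x y" and "p \<in> S" and "q \<in> S"
  shows "gmf_kernel G \<chi> k \<phi> F p q = gmf_kernel G \<chi> k \<phi> F' p q"
  unfolding gmf_kernel_def
  by (intro sum.cong refl arg_cong2[of _ _ _ _ "(*)"] prod.cong assms \<phi> index_group)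

end

section \<open>From kernels to matrices\<close>

definition gmf_mat :: "(nat \<Rightarrow> nat) set \<Rightarrow> ((nat \<Rightarrow> nat) \<Rightarrow> complex) \<Rightarrow> nat \<Rightarrow> (nat \<Rightarrow> nat \<Rightarrow> nat) \<Rightarrow>
    nat \<Rightarrow> complex mat \<Rightarrow> complex mat" where
  "gmf_mat G \<chi> k \<phi> r A = mat r r (\<lambda>(p, q). gmf_kernel G \<chi> k \<phi> (\<lambda>x y. A $$ (x, y)) p q)"

lemma gmf_mat_hlawka:
  assumes sub: "subgroup G (sym_group k)"
    and char: "irreducible_character ((sym_group k)\<lparr>carrier := G\<rparr>) \<chi>"
    and \<phi>: "\<And>p i. p \<in> {..<r} \<Longrightarrow> i \<in> {1..k} \<Longrightarrow> \<phi> p i \<in> {..<l}"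
    and A: "positive_semidefinite l A" and B: "positive_semidefinite l B"
    and C: "positive_semidefinite l C"
  defines "\<Psi> \<equiv> gmf_mat G \<chi> k \<phi> r"
  shows "loewner_ge r (\<Psi> (A + B + C) + \<Psi> A + \<Psi> B + \<Psi> C) (\<Psi> (A + B) + \<Psi> (A + C) + \<Psi> (B + C))"
proof -
  note gram = positive_semidefinite_imp_gram_on[OF A] positive_semidefinite_imp_gram_on[OF B]
    positive_semidefinite_imp_gram_on[OF C]
  have car: "A \<in> carrier_mat l l" "B \<in> carrier_mat l l" "C \<in> carrier_mat l l"
    using A B C unfolding positive_semidefinite_def hermitian_mat_def by auto
  define \<Phi> where "\<Phi> = gmf_kernel G \<chi> k \<phi>"
  have index: "\<Psi> M $$ (p, q) = \<Phi> F p q"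
    if "\<And>x y. x < l \<Longrightarrow> y < l \<Longrightarrow> M $$ (x, y) = F x y" "p < r" "q < r" for M F p q
  proof -
    have "\<Psi> M $$ (p, q) = \<Phi> (\<lambda>x y. M $$ (x, y)) p q"
      using that(2,3) by (simp add: \<Psi>_def \<Phi>_def gmf_mat_def)
    also have "\<dots> = \<Phi> F p q"
      unfolding \<Phi>_def 
      by (rule gmf_kernel_cong[where S = "{..<r}" and N = "{..<l}", OF sub char])
         (use \<phi> that in auto)
    finally show ?thesis .
  qed
  have carrier [simp]: "\<Psi> M \<in> carrier_mat r r" for M by (simp add: \<Psi>_def gmf_mat_def)
  have gram_on_\<Phi>: "gram_on {..<r} (\<Phi> F)" if "gram_on {..<l} F" for F
    unfolding \<Phi>_def by (rule gmf_kernel_gram_on[OF sub char \<phi> that])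
  let ?a = "\<lambda>x y. A $$ (x, y)" and ?b = "\<lambda>x y. B $$ (x, y)" and ?c = "\<lambda>x y. C $$ (x, y)"
  let ?ab = "\<lambda>x y. ?a x y + ?b x y" and ?ac = "\<lambda>x y. ?a x y + ?c x y"
    and ?bc = "\<lambda>x y. ?b x y + ?c x y" and ?abc = "\<lambda>x y. ?a x y + ?b x y + ?c x y"
  let ?X = "\<Psi> (A + B + C) + \<Psi> A + \<Psi> B + \<Psi> C" and ?Y = "\<Psi> (A + B) + \<Psi> (A + C) + \<Psi> (B + C)"
  have sums: "\<Psi> (A + B + C) $$ (p, q) = \<Phi> ?abc p q" "\<Psi> A $$ (p, q) = \<Phi> ?a p q"
      "\<Psi> B $$ (p, q) = \<Phi> ?b p q" "\<Psi> C $$ (p, q) = \<Phi> ?c p q" "\<Psi> (A + B) $$ (p, q) = \<Phi> ?ab p q"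
      "\<Psi> (A + C) $$ (p, q) = \<Phi> ?ac p q" "\<Psi> (B + C) $$ (p, q) = \<Phi> ?bc p q"
    if "p < r" "q < r" for p q
    using that car by (auto intro!: index)
  have X: "?X $$ (p, q) = \<Phi> ?abc p q + \<Phi> ?a p q + \<Phi> ?b p q + \<Phi> ?c p q"
    and Y: "?Y $$ (p, q) = \<Phi> ?ab p q + \<Phi> ?ac p q + \<Phi> ?bc p q"
    if "p < r" "q < r" for p q
    using that by (simp_all add: sums carrier_matD[OF carrier])
  show ?thesis
  proof (rule gram_on_imp_loewner_ge)
    have "gram_on {..<r} (\<lambda>p q. \<Phi> ?abc p q + \<Phi> ?a p q + \<Phi> ?b p q + \<Phi> ?c p q)"
      by (intro gram_on_add gram_on_\<Phi> gram)
    then show "gram_on {..<r} (\<lambda>p q. ?X $$ (p, q))" by (rule gram_on_cong) (simp add: X)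
    have "gram_on {..<r} (\<lambda>p q. \<Phi> ?ab p q + \<Phi> ?ac p q + \<Phi> ?bc p q)"
      by (intro gram_on_add gram_on_\<Phi> gram)
    then show "gram_on {..<r} (\<lambda>p q. ?Y $$ (p, q))" by (rule gram_on_cong) (simp add: Y)
    have "gram_on {..<r} (\<lambda>p q. \<Phi> ?abc p q + \<Phi> ?a p q + \<Phi> ?b p q + \<Phi> ?c p q
        - (\<Phi> ?ab p q + \<Phi> ?ac p q + \<Phi> ?bc p q))"
      unfolding \<Phi>_def by (rule gmf_kernel_hlawka[OF sub char \<phi> gram])
    then show "gram_on {..<r} (\<lambda>p q. ?X $$ (p, q) - ?Y $$ (p, q))"
      by (rule gram_on_cong) (simp add: X Y)
  qed auto
qed

section \<open>Block indices and the two partial functions\<close>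

lemma block_index_less:
  fixes i j :: nat
  assumes "i < m" and "j < n"
  shows "i * n + j < m * n"
proof -
  have "i * n + j < Suc i * n" using assms by simp
  also have "\<dots> \<le> m * n" using assms by (intro mult_le_mono1) simp
  finally show ?thesis .
qed

text \<open>Here the block index is permuted and the position inside the block is fixed. The shift
  \<open>i - 1\<close> translates permutations of \<open>{1..m}\<close> to matrix indices starting
  at 0.\<close>

lemma partial_gmf1_eq_gmf_mat:
  assumes "subgroup G (sym_group m)"
  shows "partial_gmf1 G \<chi> m n A = gmf_mat G \<chi> m (\<lambda>p i. (i - 1) * n + p) n A"
  unfolding partial_gmf1_def gmf_mat_def
proof (rule cong_mat; clarsimp)
  fix r s assume "r < n" "s < n"
  have "\<sigma> i \<in> {1..m}" if "\<sigma> \<in> G" "i \<in> {1..m}" for \<sigma> i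
    using subgroup.subset[OF assms] that permutes_in_image[of \<sigma> "{1..m}" i] by (auto simp: sym_group_def)
  \<comment> \<open>The bound is what permits reading off the entry of \<open>cross_block\<close>,
    which is built by \<open>mat\<close>.\<close>
  then have less: "\<sigma> i - Suc 0 < m" if "\<sigma> \<in> G" "i \<in> {1..m}" for \<sigma> i
    using that by fastforce
  show "gen_mat_fun G \<chi> m (cross_block m n A r s)
      = gmf_kernel G \<chi> m (\<lambda>p i. (i - Suc 0) * n + p) (\<lambda>x y. A $$ (x, y)) r s"
    unfolding gen_mat_fun_def gmf_kernel_def cross_block_def block_def
    using \<open>r < n\<close> \<open>s < n\<close>
    by (intro sum.cong refl arg_cong2[of _ _ _ _ "(*)"] prod.cong) (auto simp: less)
qed

text \<open>The roles are exchanged: the block index is fixed and the position inside the block is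
  permuted.\<close>

lemma partial_gmf2_eq_gmf_mat:
  assumes "subgroup G (sym_group n)"
  shows "partial_gmf2 G \<chi> m n A = gmf_mat G \<chi> n (\<lambda>p i. p * n + (i - 1)) m A"
  unfolding partial_gmf2_def gmf_mat_def
proof (rule cong_mat; clarsimp)
  fix i j assume "i < m" "j < m"
  have "\<sigma> r \<in> {1..n}" if "\<sigma> \<in> G" "r \<in> {1..n}" for \<sigma> r
    using subgroup.subset[OF assms] that permutes_in_image[of \<sigma> "{1..n}" r] by (auto simp: sym_group_def)
  then have less: "\<sigma> r - Suc 0 < n" if "\<sigma> \<in> G" "r \<in> {1..n}" for \<sigma> r
    using that by fastforce
  show "gen_mat_fun G \<chi> n (block n A i j)
      = gmf_kernel G \<chi> n (\<lambda>p r. p * n + (r - Suc 0)) (\<lambda>x y. A $$ (x, y)) i j"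
    unfolding gen_mat_fun_def gmf_kernel_def block_def
    by (intro sum.cong refl arg_cong2[of _ _ _ _ "(*)"] prod.cong) (auto simp: less)
qed

theorem theorem2p3:
  fixes m n :: nat and A B C :: "complex mat"
  assumes "m > 0" and "n > 0"
    and "positive_semidefinite (m * n) A"
    and "positive_semidefinite (m * n) B"
    and "positive_semidefinite (m * n) C"
  shows
    "(\<forall>G \<chi>. subgroup G (sym_group m) \<and> irreducible_character ((sym_group m)\<lparr>carrier := G\<rparr>) \<chi> \<longrightarrow>
        loewner_ge n
          (partial_gmf1 G \<chi> m n (A + B + C) + partial_gmf1 G \<chi> m n A
             + partial_gmf1 G \<chi> m n B + partial_gmf1 G \<chi> m n C)
          (partial_gmf1 G \<chi> m n (A + B) + partial_gmf1 G \<chi> m n (A + C)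
             + partial_gmf1 G \<chi> m n (B + C))) \<and>
     (\<forall>G \<chi>. subgroup G (sym_group n) \<and> irreducible_character ((sym_group n)\<lparr>carrier := G\<rparr>) \<chi> \<longrightarrow>
        loewner_ge m
          (partial_gmf2 G \<chi> m n (A + B + C) + partial_gmf2 G \<chi> m n A
             + partial_gmf2 G \<chi> m n B + partial_gmf2 G \<chi> m n C)
          (partial_gmf2 G \<chi> m n (A + B) + partial_gmf2 G \<chi> m n (A + C)
             + partial_gmf2 G \<chi> m n (B + C)))"
proof (intro conjI allI impI; elim conjE)
  fix G \<chi>
  assume sub: "subgroup G (sym_group m)"
    and char: "irreducible_character ((sym_group m)\<lparr>carrier := G\<rparr>) \<chi>"
  show "loewner_ge n
          (partial_gmf1 G \<chi> m n (A + B + C) + partial_gmf1 G \<chi> m n A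
             + partial_gmf1 G \<chi> m n B + partial_gmf1 G \<chi> m n C)
          (partial_gmf1 G \<chi> m n (A + B) + partial_gmf1 G \<chi> m n (A + C)
             + partial_gmf1 G \<chi> m n (B + C))"
    unfolding partial_gmf1_eq_gmf_mat[OF sub]
    by (rule gmf_mat_hlawka[OF sub char _ assms(3-5)]) (auto intro!: block_index_less)
next
  fix G \<chi>
  assume sub: "subgroup G (sym_group n)"
    and char: "irreducible_character ((sym_group n)\<lparr>carrier := G\<rparr>) \<chi>"
  show "loewner_ge m
          (partial_gmf2 G \<chi> m n (A + B + C) + partial_gmf2 G \<chi> m n A
             + partial_gmf2 G \<chi> m n B + partial_gmf2 G \<chi> m n C)
          (partial_gmf2 G \<chi> m n (A + B) + partial_gmf2 G \<chi> m n (A + C)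
             + partial_gmf2 G \<chi> m n (B + C))"
    unfolding partial_gmf2_eq_gmf_mat[OF sub]
  proof (rule gmf_mat_hlawka[OF sub char _ assms(3-5)])
    fix p i assume "p \<in> {..<m}" "i \<in> {1..n}"
    then show "p * n + (i - 1) \<in> {..<m * n}"
      using block_index_less[of p m "i - 1" n] by auto
  qed
qed

end
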